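(* Let $f,g,D,\mathcal L_*,p_*$ be as in the context. Suppose $$\lambda:=\inf_{x\in\mathbb R^n}\lambda_{\min}(D(x))>0,\qquad \mu:=-\sup_{x\in\mathbb R^n}\lambda_{\max}\big((\ln p_* )''(x)\big)>0 .$$ Suppose also that $$\mathbf E_*|\mathcal L_*(\ln p_* )|<+\infty,\qquad \mathbf E_*|\mathrm{div}\,f|<+\infty,$$ that the pair $(p_*,\ln p_* )$ is $(f,D)$-decaying, and that the pair $(1,p_* )$ is $(f,0)$-decaying. Then $K:=\frac1{\lambda\mu}$ satisfies $$K\ge-\frac{n}{2\,\mathbf E_*\,\mathrm{div}\,f}.$$
   Context: Setting. Let $f\in C^1(\mathbb R^n,\mathbb R^n)$ and $g\in C^2(\mathbb R^n,\mathbb R^{n\times m})$ be Lipschitz maps, and $D(x):=g(x)g(x)^{\mathrm T}$. The nominal system is the Ito SDE $dX_t=f(X_t)\,dt+g(X_t)\,dV_t$ with a standard Wiener process $V$ in $\mathbb R^m$. For a matrix-valued $G=(G_{jk})\in C^2(\mathbb R^n,\mathbb S_n)$ ($\mathbb S_n$ = real symmetric matrices of order $n$), $\mathrm{div}\,G:=(\sum_k\partial_{x_k}G_{jk})_{1\le j\le n}$ and $\mathrm{div}^2G:=\sum_{j,k}\partial_{x_j}\partial_{x_k}G_{jk}$. For $\varphi\in C^2(\mathbb R^n,\mathbb R)$ with gradient $\nabla\varphi$ and Hessian $\varphi''$, $$\mathcal L_*(\varphi):=f^{\mathrm T}\nabla\varphi+\tfrac12\mathrm{Tr}(D\varphi''),\qquad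 \mathcal L_*^\dagger(\varphi):=\tfrac12\mathrm{div}^2(\varphi D)-\mathrm{div}(\varphi f).$$ $p_*$ is the (assumed to exist and to be unique) $C^2$ probability density function on $\mathbb R^n$ satisfying $\mathcal L_*^\dagger(p_* )=0$; it is assumed positive everywhere. $\mathbf E_*\varphi:=\int_{\mathbb R^n}\varphi(x)p_*(x)\,dx$. $\lambda_{\min}$ and $\lambda_{\max}$ are the smallest and largest eigenvalues of a real symmetric matrix. Definition (decaying pair). For $\phi\in C^1(\mathbb R^n,\mathbb R^n)$ and $G\in C^2(\mathbb R^n,\mathbb S_n)$, a pair $(u,v)$ of functions $u,v\in C^2(\mathbb R^n,\mathbb R)$ is called $(\phi,G)$-decaying if $$\Big(\phi-\tfrac12\mathrm{div}\,G\Big)uv+\tfrac12G(u\nabla v-v\nabla u)=o(|x|^{1-n})\quad\text{as }x\to\infty .$$ In particular, $(1,p_* )$ being $(f,0)$-decaying means $p_*(x)f(x)=o(|x|^{1-n})$ as $x\to\infty$. *)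

theory Defs
  imports "HOL-Analysis.Analysis" "HOL-Library.Landau_Symbols"
begin

definition C1 :: "('a::real_normed_vector \<Rightarrow> 'b::real_normed_vector) \<Rightarrow> bool" where
  "C1 h \<longleftrightarrow> (\<exists>h' :: 'a \<Rightarrow> 'a \<Rightarrow>\<^sub>L 'b.
      (\<forall>x. (h has_derivative blinfun_apply (h' x)) (at x)) \<and> continuous_on UNIV h')"

definition C2 :: "('a::real_normed_vector \<Rightarrow> 'b::real_normed_vector) \<Rightarrow> bool" where
  "C2 h \<longleftrightarrow> (\<exists>h' :: 'a \<Rightarrow> 'a \<Rightarrow>\<^sub>L 'b.
      (\<forall>x. (h has_derivative blinfun_apply (h' x)) (at x)) \<and> C1 h')"

definition partial_deriv :: "'n \<Rightarrow> (real^'n \<Rightarrow> real) \<Rightarrow> real^'n \<Rightarrow> real" where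
  "partial_deriv k h x = frechet_derivative h (at x) (axis k 1)"

definition grad :: "(real^'n \<Rightarrow> real) \<Rightarrow> real^'n \<Rightarrow> real^'n" where
  "grad \<phi> x = (\<chi> j. partial_deriv j \<phi> x)"

definition hessian :: "(real^'n \<Rightarrow> real) \<Rightarrow> real^'n \<Rightarrow> real^'n^'n" where
  "hessian \<phi> x = (\<chi> j k. partial_deriv j (partial_deriv k \<phi>) x)"

definition div_vec :: "(real^'n \<Rightarrow> real^'n) \<Rightarrow> real^'n \<Rightarrow> real" where
  "div_vec F x = (\<Sum>k\<in>UNIV. partial_deriv k (\<lambda>y. F y $ k) x)"

definition div_mat :: "(real^'n \<Rightarrow> real^'n^'n) \<Rightarrow> real^'n \<Rightarrow> real^'n" where
  "div_mat G x = (\<chi> j. \<Sum>k\<in>UNIV. partial_deriv k (\<lambda>y. G y $ j $ k) x)"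

definition div2 :: "(real^'n \<Rightarrow> real^'n^'n) \<Rightarrow> real^'n \<Rightarrow> real" where
  "div2 G x = (\<Sum>j\<in>UNIV. \<Sum>k\<in>UNIV. partial_deriv j (partial_deriv k (\<lambda>y. G y $ j $ k)) x)"

definition diffusion :: "(real^'n \<Rightarrow> real^'m^'n) \<Rightarrow> real^'n \<Rightarrow> real^'n^'n" where
  "diffusion g x = g x ** transpose (g x)"

definition generator ::
    "(real^'n \<Rightarrow> real^'n) \<Rightarrow> (real^'n \<Rightarrow> real^'n^'n) \<Rightarrow> (real^'n \<Rightarrow> real) \<Rightarrow> real^'n \<Rightarrow> real" where
  "generator f D \<phi> x = f x \<bullet> grad \<phi> x + 1/2 * trace (D x ** hessian \<phi> x)"

definition adjoint_generator ::
    "(real^'n \<Rightarrow> real^'n) \<Rightarrow> (real^'n \<Rightarrow> real^'n^'n) \<Rightarrow> (real^'n \<Rightarrow> real) \<Rightarrow> real^'n \<Rightarrow> real" where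
  "adjoint_generator f D \<phi> x =
     1/2 * div2 (\<lambda>y. \<phi> y *\<^sub>R D y) x - div_vec (\<lambda>y. \<phi> y *\<^sub>R f y) x"

definition invariant_density ::
    "(real^'n \<Rightarrow> real^'n) \<Rightarrow> (real^'n \<Rightarrow> real^'n^'n) \<Rightarrow> (real^'n \<Rightarrow> real) \<Rightarrow> bool" where
  "invariant_density f D p \<longleftrightarrow>
     C2 p \<and> (\<forall>x. 0 \<le> p x) \<and> (\<integral>\<^sup>+x. ennreal (p x) \<partial>lborel) = 1 \<and>
     (\<forall>x. adjoint_generator f D p x = 0)"

definition expect :: "(real^'n \<Rightarrow> real) \<Rightarrow> (real^'n \<Rightarrow> real) \<Rightarrow> real" where
  "expect p \<phi> = (\<integral>x. \<phi> x * p x \<partial>lborel)"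

definition expect_abs :: "(real^'n \<Rightarrow> real) \<Rightarrow> (real^'n \<Rightarrow> real) \<Rightarrow> ennreal" where
  "expect_abs p \<phi> = (\<integral>\<^sup>+x. ennreal (\<bar>\<phi> x\<bar> * p x) \<partial>lborel)"

definition eigenvalues :: "real^'n^'n \<Rightarrow> real set" where
  "eigenvalues A = {c. \<exists>v. v \<noteq> 0 \<and> A *v v = c *\<^sub>R v}"

text \<open>Meaningful for symmetric matrices, whose set of real eigenvalues is finite and nonempty.\<close>

definition lambda_min :: "real^'n^'n \<Rightarrow> real" where
  "lambda_min A = Min (eigenvalues A)"

definition lambda_max :: "real^'n^'n \<Rightarrow> real" where
  "lambda_max A = Max (eigenvalues A)"

text \<open>
  The pair \<open>(u, v)\<close> is \<open>(\<phi>, G)\<close>-decaying.  Only the decay condition is recorded; the notion is meant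
  for \<open>\<phi>\<close> of class C1, for \<open>u\<close>, \<open>v\<close> of class C2 and for \<open>G\<close> of class C2 with symmetric values.
  The norm is taken because Landau symbols are for functions with values in a field.
\<close>

definition decaying ::
    "(real^'n \<Rightarrow> real^'n) \<Rightarrow> (real^'n \<Rightarrow> real^'n^'n) \<Rightarrow>
     (real^'n \<Rightarrow> real) \<Rightarrow> (real^'n \<Rightarrow> real) \<Rightarrow> bool" where
  "decaying \<phi> G u v \<longleftrightarrow>
     (\<lambda>x. norm ((u x * v x) *\<^sub>R (\<phi> x - (1/2) *\<^sub>R div_mat G x)
                + (1/2) *\<^sub>R (G x *v (u x *\<^sub>R grad v x - v x *\<^sub>R grad u x))))
       \<in> o[at_infinity](\<lambda>x. norm x powr (1 - real CARD('n)))"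

end

theory Submission
  imports Defs
begin

text \<open>
  Write \<open>w = ln p\<close> and let \<open>\<chi>\<^sub>R\<close> be a cutoff equal to 1 on the ball of radius \<open>R\<close>, with gradient of order
  \<open>1 / R\<close> and support in the ball of radius \<open>2 R\<close>. For a C1 field \<open>H = o(|x| powr (1 - n))\<close>, the integral of
  \<open>\<chi>\<^sub>R div H\<close> tends to zero. The two decay conditions provide two such fields, whose divergences are
  \<open>p (f \<bullet> \<nabla>w + Tr (D w'') / 2)\<close> and \<open>p (f \<bullet> \<nabla>w + div f)\<close>. Subtracting, the integral of
  \<open>\<chi>\<^sub>R p (div f - Tr (D w'') / 2)\<close> tends to zero, while \<open>Tr (D w'') \<le> - n lam mu\<close> pointwise. Hence the expectation
  of \<open>div f\<close> is at most \<open>- n lam mu / 2\<close>, which is the claim.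
\<close>

section \<open>Functions with continuous partial derivatives\<close>

text \<open>Differentiability is a separate conjunct because \<open>frechet_derivative\<close>, and
  with it \<open>partial_deriv\<close>, is an arbitrary choice at points where no derivative
  exists.\<close>

definition C1_partials :: "(real^'n \<Rightarrow> real) \<Rightarrow> bool" where
  "C1_partials h \<longleftrightarrow>
     (\<forall>x. h differentiable at x) \<and> (\<forall>k. continuous_on UNIV (partial_deriv k h))"

definition C2_partials :: "(real^'n \<Rightarrow> real) \<Rightarrow> bool" where
  "C2_partials h \<longleftrightarrow> C1_partials h \<and> (\<forall>k. C1_partials (partial_deriv k h))"

section \<open>Calculus rules for partial derivatives\<close>

lemma partial_deriv_eq:
  "(h has_derivative h') (at x) \<Longrightarrow> partial_deriv k h x = h' (axis k 1)"
  unfolding partial_deriv_def using frechet_derivative_at by metis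

lemma differentiable_has_derivative_at:
  "h differentiable at x \<Longrightarrow> (h has_derivative frechet_derivative h (at x)) (at x)"
  using frechet_derivative_works by blast

lemma partial_deriv_const [simp]: "partial_deriv k (\<lambda>_. c) = (\<lambda>_. 0)"
  by (rule ext, subst partial_deriv_eq[where h' = "\<lambda>_. 0"]) auto

lemma partial_deriv_add:
  assumes "u differentiable at x" "v differentiable at x"
  shows "partial_deriv k (\<lambda>y. u y + v y) x = partial_deriv k u x + partial_deriv k v x"
  by (subst partial_deriv_eq[OF has_derivative_add[OF assms[THEN differentiable_has_derivative_at]]])
     (simp add: partial_deriv_def)

lemma partial_deriv_mult:
  assumes "u differentiable at x" "v differentiable at x"
  shows "partial_deriv k (\<lambda>y. u y * v y) x = partial_deriv k u x * v x + u x * partial_deriv k v x"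
  by (subst partial_deriv_eq[OF has_derivative_mult[OF assms[THEN differentiable_has_derivative_at]]])
     (simp add: partial_deriv_def)

lemma partial_deriv_compose:
  fixes u :: "real^'n \<Rightarrow> real"
  assumes "u differentiable at x" "(F has_real_derivative F') (at (u x))"
  shows "(\<lambda>y. F (u y)) differentiable at x"
    and "partial_deriv k (\<lambda>y. F (u y)) x = F' * partial_deriv k u x"
proof -
  have "((\<lambda>y. F (u y)) has_derivative (\<lambda>y. F' * frechet_derivative u (at x) y)) (at x)"
    using has_derivative_compose[OF differentiable_has_derivative_at[OF assms(1)]
        assms(2)[unfolded has_field_derivative_def]] .
  then show "(\<lambda>y. F (u y)) differentiable at x"
    and "partial_deriv k (\<lambda>y. F (u y)) x = F' * partial_deriv k u x"
    by (auto simp: differentiable_def partial_deriv_eq) (simp add: partial_deriv_def)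
qed

lemma C1_partialsD:
  assumes "C1_partials h"
  shows "h differentiable at x" "continuous_on UNIV h" "continuous_on UNIV (partial_deriv k h)"
  using assms
  by (auto simp: C1_partials_def differentiable_imp_continuous_within continuous_on_eq_continuous_within)

lemma C2_partialsD:
  assumes "C2_partials h"
  shows "C1_partials h" "C1_partials (partial_deriv k h)"
  using assms by (auto simp: C2_partials_def)

lemma C1_partials_const [simp]: "C1_partials (\<lambda>_. c)"
  by (simp add: C1_partials_def)

lemma C1_partials_add:
  assumes "C1_partials u" "C1_partials v"
  shows "C1_partials (\<lambda>x. u x + v x)"
proof -
  have "continuous_on UNIV (\<lambda>x. partial_deriv k u x + partial_deriv k v x)" for k
    by (intro continuous_intros C1_partialsD assms)
  then show ?thesis
    using assms[THEN C1_partialsD(1)]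
    by (auto simp: C1_partials_def partial_deriv_add cong: continuous_on_cong)
qed

lemma C1_partials_mult:
  assumes "C1_partials u" "C1_partials v"
  shows "C1_partials (\<lambda>x. u x * v x)"
proof -
  have "continuous_on UNIV (\<lambda>x. partial_deriv k u x * v x + u x * partial_deriv k v x)" for k
    by (intro continuous_intros C1_partialsD assms)
  then show ?thesis
    using assms[THEN C1_partialsD(1)]
    by (auto simp: C1_partials_def partial_deriv_mult cong: continuous_on_cong)
qed

lemma partial_deriv_diff:
  assumes "u differentiable at x" "v differentiable at x"
  shows "partial_deriv k (\<lambda>y. u y - v y) x = partial_deriv k u x - partial_deriv k v x"
  by (subst partial_deriv_eq[OF has_derivative_diff[OF assms[THEN differentiable_has_derivative_at]]])
     (simp add: partial_deriv_def)

lemma C1_partials_diff: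
  assumes "C1_partials u" "C1_partials v"
  shows "C1_partials (\<lambda>x. u x - v x)"
proof -
  have "C1_partials (\<lambda>x. u x + (-1) * v x)"
    by (intro C1_partials_add C1_partials_mult assms C1_partials_const)
  then show ?thesis by simp
qed

lemma C1_partials_sum:
  assumes "\<And>i. i \<in> I \<Longrightarrow> C1_partials (u i)"
  shows "C1_partials (\<lambda>x. \<Sum>i\<in>I. u i x)"
  \<comment> \<open>For an infinite \<open>I\<close> the sum is 0 by convention, so that case is
    about a constant function.\<close>
  using assms by (induction I rule: infinite_finite_induct) (auto intro!: C1_partials_add)

lemma partial_deriv_sum:
  assumes "\<And>i. i \<in> I \<Longrightarrow> C1_partials (u i)"
  shows "partial_deriv k (\<lambda>y. \<Sum>i\<in>I. u i y) x = (\<Sum>i\<in>I. partial_deriv k (u i) x)"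
  using assms
  by (induction I rule: infinite_finite_induct)
     (simp_all add: partial_deriv_add C1_partialsD(1) C1_partials_sum)

text \<open>\<open>F\<close> is constrained only at the values of \<open>u\<close>, so that
  \<open>ln\<close> and \<open>inverse\<close> qualify along a positive \<open>u\<close>.\<close>

lemma C1_partials_compose:
  assumes "C1_partials u"
    and "\<And>x. (F has_real_derivative F' (u x)) (at (u x))" "continuous_on UNIV (\<lambda>x. F' (u x))"
  shows "C1_partials (\<lambda>x. F (u x))"
proof -
  have "continuous_on UNIV (\<lambda>x. F' (u x) * partial_deriv k u x)" for k
    by (intro continuous_intros C1_partialsD assms)
  then show ?thesis
    using partial_deriv_compose[OF C1_partialsD(1)[OF assms(1)] assms(2)]
    by (auto simp: C1_partials_def cong: continuous_on_cong)
qed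

lemma C2_partials_const [simp]: "C2_partials (\<lambda>_. c)"
  by (simp add: C2_partials_def)

lemma C2_partials_add:
  assumes "C2_partials u" "C2_partials v"
  shows "C2_partials (\<lambda>x. u x + v x)"
proof -
  have "partial_deriv k (\<lambda>x. u x + v x) = (\<lambda>x. partial_deriv k u x + partial_deriv k v x)" for k
    using assms[THEN C2_partialsD(1), THEN C1_partialsD(1)] by (auto simp: partial_deriv_add)
  then show ?thesis
    using assms by (auto simp: C2_partials_def intro: C1_partials_add)
qed

lemma C2_partials_mult:
  assumes "C2_partials u" "C2_partials v"
  shows "C2_partials (\<lambda>x. u x * v x)"
proof -
  have "partial_deriv k (\<lambda>x. u x * v x) = (\<lambda>x. partial_deriv k u x * v x + u x * partial_deriv k v x)" for k
    using assms[THEN C2_partialsD(1), THEN C1_partialsD(1)] by (auto simp: partial_deriv_mult)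
  then show ?thesis
    using assms by (auto simp: C2_partials_def intro!: C1_partials_add C1_partials_mult)
qed

lemma C2_partials_sum:
  assumes "\<And>i. i \<in> I \<Longrightarrow> C2_partials (u i)"
  shows "C2_partials (\<lambda>x. \<Sum>i\<in>I. u i x)"
  using assms by (induction I rule: infinite_finite_induct) (auto intro!: C2_partials_add)

text \<open>The first partials are \<open>inverse (p x) * partial_deriv k p x\<close>, a product of
  C1 functions because \<open>p\<close> never meets the singularity at 0.\<close>

lemma C2_partials_ln:
  assumes "C2_partials p" and pos: "\<And>x. p x > 0"
  shows "C2_partials (\<lambda>x. ln (p x))"
proof -
  have p: "C1_partials p" and dp: "C1_partials (partial_deriv k p)" for k
    using assms(1) by (auto dest: C2_partialsD)
  have nz: "p x \<noteq> 0" for x using pos[of x] by simp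
  have ln: "(ln has_real_derivative 1 / p x) (at (p x))" for x
    using pos by (rule DERIV_ln_divide)
  have inv: "C1_partials (\<lambda>x. inverse (p x))"
    using nz by (intro C1_partials_compose[OF p, where F' = "\<lambda>y. - (inverse y ^ 2)"])
      (auto intro!: DERIV_cong[OF DERIV_inverse] simp: power2_eq_square intro!: continuous_intros C1_partialsD(2)[OF p])
  have "partial_deriv k (\<lambda>x. ln (p x)) = (\<lambda>x. inverse (p x) * partial_deriv k p x)" for k
    using partial_deriv_compose(2)[OF C1_partialsD(1)[OF p] ln] by (simp add: fun_eq_iff inverse_eq_divide)
  moreover have "C1_partials (\<lambda>x. ln (p x))"
    using nz by (intro C1_partials_compose[OF p ln] continuous_intros C1_partialsD(2)[OF p]) auto
  ultimately show ?thesis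
    using inv dp by (simp add: C2_partials_def C1_partials_mult)
qed

section \<open>From derivatives valued in bounded linear maps to partial derivatives\<close>

lemma C1_imp_C1_partials:
  fixes h :: "real^'n \<Rightarrow> real"
  assumes "C1 h" shows "C1_partials h"
proof -
  obtain h' :: "real^'n \<Rightarrow> (real^'n) \<Rightarrow>\<^sub>L real"
    where h': "\<And>x. (h has_derivative blinfun_apply (h' x)) (at x)" "continuous_on UNIV h'"
    using assms unfolding C1_def by blast
  have "partial_deriv k h = (\<lambda>x. h' x (axis k 1))" for k
    using partial_deriv_eq[OF h'(1)] by auto
  then show ?thesis
    using h' by (auto simp: C1_partials_def differentiable_def intro!: continuous_intros)
qed

lemma C1_bounded_linear:
  assumes "C1 h" "bounded_linear T" shows "C1 (\<lambda>x. T (h x))"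
proof -
  obtain h' where h': "\<And>x. (h has_derivative blinfun_apply (h' x)) (at x)" "continuous_on UNIV h'"
    using assms(1) unfolding C1_def by blast
  let ?d = "\<lambda>x. Blinfun T o\<^sub>L h' x"
  have "((\<lambda>x. T (h x)) has_derivative blinfun_apply (?d x)) (at x)" for x
    using bounded_linear.has_derivative[OF assms(2) h'(1), of x]
    by (rule has_derivative_eq_rhs)
       (auto simp: blinfun_apply_blinfun_compose bounded_linear_Blinfun_apply[OF assms(2)])
  moreover have "continuous_on UNIV ?d"
    by (intro continuous_intros h')
  ultimately show ?thesis unfolding C1_def by (intro exI[of _ ?d]) simp
qed

text \<open>The derivative of the composite is \<open>Blinfun T o\<^sub>L h' x\<close>. Composing
  with \<open>Blinfun T\<close> on the left is again bounded and linear, so the first-order result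
  applies to this derivative.\<close>

lemma C2_bounded_linear:
  assumes "C2 h" "bounded_linear T" shows "C2 (\<lambda>x. T (h x))"
proof -
  obtain h' where h': "\<And>x. (h has_derivative blinfun_apply (h' x)) (at x)" "C1 h'"
    using assms(1) unfolding C2_def by blast
  let ?d = "\<lambda>x. Blinfun T o\<^sub>L h' x"
  have "((\<lambda>x. T (h x)) has_derivative blinfun_apply (?d x)) (at x)" for x
    using bounded_linear.has_derivative[OF assms(2) h'(1), of x]
    by (rule has_derivative_eq_rhs)
       (auto simp: blinfun_apply_blinfun_compose bounded_linear_Blinfun_apply[OF assms(2)])
  moreover have "C1 ?d"
    by (rule C1_bounded_linear[OF h'(2)])
       (rule bounded_bilinear.bounded_linear_right[OF bounded_bilinear_blinfun_compose])
  ultimately show ?thesis unfolding C2_def by (intro exI[of _ ?d]) simp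
qed

lemma C2_imp_C2_partials:
  fixes h :: "real^'n \<Rightarrow> real"
  assumes "C2 h" shows "C2_partials h"
proof -
  obtain h' :: "real^'n \<Rightarrow> (real^'n) \<Rightarrow>\<^sub>L real"
    where h': "\<And>x. (h has_derivative blinfun_apply (h' x)) (at x)" "C1 h'"
    using assms unfolding C2_def by blast
  have pd: "partial_deriv k h = (\<lambda>x. h' x (axis k 1))" for k
    using partial_deriv_eq[OF h'(1)] by auto
  have "C1_partials (partial_deriv k h)" for k
    unfolding pd
    by (intro C1_imp_C1_partials C1_bounded_linear[OF h'(2)] blinfun.bounded_linear_left)
  \<comment> \<open>The first partials are differentiable, hence continuous, which gives the C1
    regularity of \<open>h\<close> itself.\<close>
  moreover from this have "C1_partials h"
    using h' by (auto simp: C1_partials_def[of h] differentiable_def C1_partialsD(2))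
  ultimately show ?thesis by (simp add: C2_partials_def)
qed

section \<open>Symmetry of second partial derivatives\<close>

lemma has_real_derivative_along_axis:
  fixes h :: "real^'n \<Rightarrow> real"
  assumes "h differentiable at (x + s *\<^sub>R axis k 1)"
  shows "((\<lambda>s. h (x + s *\<^sub>R axis k 1)) has_real_derivative partial_deriv k h (x + s *\<^sub>R axis k 1)) (at s)"
proof -
  let ?A = "frechet_derivative h (at (x + s *\<^sub>R axis k 1))"
  have "((\<lambda>s. x + s *\<^sub>R axis k 1) has_derivative (\<lambda>s. s *\<^sub>R axis k 1)) (at s)"
    by (auto intro!: derivative_eq_intros)
  from has_derivative_compose[OF this differentiable_has_derivative_at[OF assms]]
  have "((\<lambda>s. h (x + s *\<^sub>R axis k 1)) has_derivative (\<lambda>t. ?A (t *\<^sub>R axis k 1))) (at s)" .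
  moreover have "?A (t *\<^sub>R axis k 1) = partial_deriv k h (x + s *\<^sub>R axis k 1) * t" for t
    using linear_cmul[OF linear_frechet_derivative[OF assms]]
    by (simp add: partial_deriv_def)
  ultimately show ?thesis
    by (simp add: has_field_derivative_def)
qed

lemma partial_deriv_mvt:
  fixes h :: "real^'n \<Rightarrow> real"
  assumes "\<And>y. h differentiable at y" "e > 0"
  shows "\<exists>s. 0 < s \<and> s < e \<and>
    h (x + e *\<^sub>R axis k 1) - h x = e * partial_deriv k h (x + s *\<^sub>R axis k 1)"
  using MVT2[of 0 e "\<lambda>s. h (x + s *\<^sub>R axis k 1)" "\<lambda>s. partial_deriv k h (x + s *\<^sub>R axis k 1)"]
    has_real_derivative_along_axis assms by fastforce

text \<open>The second difference is the increment in direction \<open>j\<close> of the increment of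
  \<open>h\<close> in direction \<open>k\<close>. The mean value theorem is applied in direction
  \<open>j\<close> to that increment and then in direction \<open>k\<close> to
  \<open>partial_deriv j h\<close>.\<close>

lemma second_difference_mvt:
  fixes h :: "real^'n \<Rightarrow> real"
  assumes "C2_partials h" and e: "e > 0"
  shows "\<exists>y\<in>cball x (2 * e).
    h (x + e *\<^sub>R axis j 1 + e *\<^sub>R axis k 1) - h (x + e *\<^sub>R axis j 1) - h (x + e *\<^sub>R axis k 1) + h x
      = e\<^sup>2 * partial_deriv k (partial_deriv j h) y"
proof -
  have h: "h differentiable at y" "partial_deriv i h differentiable at y" for y i
    using assms by (auto dest: C2_partialsD intro: C1_partialsD)
  define \<phi> where "\<phi> y = h (y + e *\<^sub>R axis k 1) - h y" for y
  have shift: "((\<lambda>y. h (y + e *\<^sub>R axis k 1)) has_derivative frechet_derivative h (at (y + e *\<^sub>R axis k 1))) (at y)" for y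
    by (rule has_derivative_compose[OF _ differentiable_has_derivative_at[OF h(1)],
        of "\<lambda>y. y + e *\<^sub>R axis k 1" "\<lambda>y. y" y UNIV])
      (auto intro!: derivative_eq_intros)
  have d\<phi>: "(\<phi> has_derivative (\<lambda>v. frechet_derivative h (at (y + e *\<^sub>R axis k 1)) v - frechet_derivative h (at y) v)) (at y)" for y
    unfolding \<phi>_def
    by (intro has_derivative_diff shift differentiable_has_derivative_at h)
  have pd: "partial_deriv j \<phi> y = partial_deriv j h (y + e *\<^sub>R axis k 1) - partial_deriv j h y" for y
    by (subst partial_deriv_eq[OF d\<phi>]) (simp add: partial_deriv_def)
  obtain s where s: "0 < s" "s < e"
    "\<phi> (x + e *\<^sub>R axis j 1) - \<phi> x = e * partial_deriv j \<phi> (x + s *\<^sub>R axis j 1)"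
    using partial_deriv_mvt[of \<phi> e x j] d\<phi> e unfolding differentiable_def by metis
  obtain t where t: "0 < t" "t < e"
    "partial_deriv j \<phi> (x + s *\<^sub>R axis j 1)
      = e * partial_deriv k (partial_deriv j h) (x + s *\<^sub>R axis j 1 + t *\<^sub>R axis k 1)"
    using partial_deriv_mvt[OF h(2) e, of j "x + s *\<^sub>R axis j 1" k] unfolding pd by metis
  let ?y = "x + s *\<^sub>R axis j 1 + t *\<^sub>R axis k 1"
  \<comment> \<open>The point is reached by two axis steps of lengths \<open>s\<close> and
    \<open>t\<close> below \<open>e\<close>, whence the radius \<open>2 * e\<close>.\<close>
  have "norm (s *\<^sub>R axis j (1::real) + t *\<^sub>R axis k 1) \<le> norm (s *\<^sub>R axis j (1::real)) + norm (t *\<^sub>R axis k (1::real))"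
    by (rule norm_triangle_ineq)
  then have "?y \<in> cball x (2 * e)"
    using s t unfolding mem_cball dist_commute[of x] by (simp add: dist_norm add.assoc)
  moreover have "h (x + e *\<^sub>R axis j 1 + e *\<^sub>R axis k 1) - h (x + e *\<^sub>R axis j 1) - h (x + e *\<^sub>R axis k 1) + h x
      = e\<^sup>2 * partial_deriv k (partial_deriv j h) ?y"
    using s(3) t(3) by (simp add: \<phi>_def power2_eq_square algebra_simps)
  ultimately show ?thesis by blast
qed

text \<open>The second difference is symmetric in \<open>j\<close> and \<open>k\<close>, so both
  mixed partials take a common value at points within \<open>2 * e\<close> of \<open>x\<close>.
  Their continuity transfers the equality to \<open>x\<close> as \<open>e\<close> tends to
  0.\<close>

lemma partial_deriv_commute:
  fixes h :: "real^'n \<Rightarrow> real"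
  assumes "C2_partials h"
  shows "partial_deriv j (partial_deriv k h) x = partial_deriv k (partial_deriv j h) x"
proof -
  define e where "e i = inverse (real (Suc i))" for i
  have e: "e i > 0" for i by (simp add: e_def)
  have e0: "e \<longlonglongrightarrow> 0" unfolding e_def by (rule LIMSEQ_inverse_real_of_nat)
  let ?P = "partial_deriv j (partial_deriv k h)" and ?Q = "partial_deriv k (partial_deriv j h)"
  \<comment> \<open>The two points are packed into one pair \<open>w\<close>, so that a single
    choice yields both sequences.\<close>
  define near where "near i w \<longleftrightarrow> dist x (fst w) \<le> 2 * e i \<and> dist x (snd w) \<le> 2 * e i \<and> ?Q (fst w) = ?P (snd w)" for i w
  have "\<exists>w. near i w" for i
  proof -
    let ?d = "h (x + e i *\<^sub>R axis j 1 + e i *\<^sub>R axis k 1) - h (x + e i *\<^sub>R axis j 1) - h (x + e i *\<^sub>R axis k 1) + h x"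
    obtain y where y: "y \<in> cball x (2 * e i)" "?d = (e i)\<^sup>2 * ?Q y"
      using second_difference_mvt[OF assms e, of x i j k] by blast
    obtain z where z: "z \<in> cball x (2 * e i)" "?d = (e i)\<^sup>2 * ?P z"
      using second_difference_mvt[OF assms e, of x i k j] by (auto simp: add_ac algebra_simps)
    have "?Q y = ?P z" using y(2) z(2) e[of i] by simp
    then have "near i (y, z)" using y(1) z(1) by (simp add: near_def)
    then show ?thesis ..
  qed
  then obtain w where "\<And>i. near i (w i)" by metis
  then have w: "dist x (fst (w i)) \<le> 2 * e i" "dist x (snd (w i)) \<le> 2 * e i"
    "?Q (fst (w i)) = ?P (snd (w i))" for i
    by (auto simp: near_def)
  have lim: "w \<longlonglongrightarrow> x" if "\<And>i. dist x (w i) \<le> 2 * e i" for w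
  proof (rule iffD2[OF tendsto_dist_iff], rule tendsto_sandwich[OF _ _ tendsto_const])
    show "(\<lambda>i. 2 * e i) \<longlonglongrightarrow> 0" using tendsto_mult_right[OF e0, of 2] by simp
  qed (use that in \<open>auto simp: dist_commute\<close>)
  have cont: "isCont (partial_deriv a (partial_deriv b h)) x" for a b
    using assms by (meson C1_partialsD(3) C2_partialsD(2) UNIV_I continuous_on_eq_continuous_at open_UNIV)
  have "(\<lambda>i. ?Q (fst (w i))) \<longlonglongrightarrow> ?Q x"
    by (rule isCont_tendsto_compose[OF cont lim[OF w(1)]])
  moreover have "(\<lambda>i. ?Q (fst (w i))) \<longlonglongrightarrow> ?P x"
    unfolding w(3) by (rule isCont_tendsto_compose[OF cont lim[OF w(2)]])
  ultimately show ?thesis by (rule LIMSEQ_unique[symmetric])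
qed

section \<open>Quadratic forms of symmetric matrices\<close>

lemma symmetric_matrix_inner:
  fixes A :: "real^'n^'n"
  assumes "transpose A = A"
  shows "(A *v x) \<bullet> y = x \<bullet> (A *v y)"
  by (metis assms dot_lmul_matrix transpose_matrix_vector)

text \<open>Eigenvectors for distinct eigenvalues are orthogonal, hence independent, hence finite in
  number. Finiteness is what makes the \<open>Min\<close> and \<open>Max\<close> in
  \<open>lambda_min\<close> and \<open>lambda_max\<close> true bounds.\<close>

lemma finite_eigenvalues_symmetric:
  fixes A :: "real^'n^'n"
  assumes A: "transpose A = A"
  shows "finite (eigenvalues A)"
proof -
  have "\<forall>c\<in>eigenvalues A. \<exists>v. v \<noteq> 0 \<and> A *v v = c *\<^sub>R v"
    by (simp add: eigenvalues_def)
  then obtain v where v: "\<And>c. c \<in> eigenvalues A \<Longrightarrow> v c \<noteq> 0 \<and> A *v v c = c *\<^sub>R v c"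
    by metis
  have orth: "v c \<bullet> v d = 0" if "c \<in> eigenvalues A" "d \<in> eigenvalues A" "c \<noteq> d" for c d
  proof -
    have "c * (v c \<bullet> v d) = d * (v c \<bullet> v d)"
      using symmetric_matrix_inner[OF A, of "v c" "v d"] v that by simp
    then show ?thesis using that(3) by simp
  qed
  \<comment> \<open>A vector shared by two eigenvalues would be orthogonal to itself.\<close>
  have inj: "inj_on v (eigenvalues A)"
    by (rule inj_onI) (metis orth v inner_eq_zero_iff)
  have "pairwise orthogonal (v ` eigenvalues A)"
    by (auto simp: pairwise_def orthogonal_def intro!: orth)
  moreover have "0 \<notin> v ` eigenvalues A" using v by auto
  ultimately have "independent (v ` eigenvalues A)"
    by (rule pairwise_orthogonal_independent)
  then have "finite (v ` eigenvalues A)" by (rule independent_imp_finite)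
  then show ?thesis using inj finite_imageD by blast
qed

text \<open>The maximizer of the quadratic form on the unit sphere is an eigenvector: the form
  \<open>c |x|\<^sup>2 - x \<bullet> A x\<close> is nonnegative and vanishes at the maximizer \<open>v\<close>, so its
  values at \<open>v + t w\<close> with \<open>t\<close> small force the gradient at \<open>v\<close> to be zero.\<close>

lemma symmetric_matrix_rayleigh:
  fixes A :: "real^'n^'n"
  assumes A: "transpose A = A"
  shows "\<exists>c\<in>eigenvalues A. \<forall>x. x \<bullet> (A *v x) \<le> c * (x \<bullet> x)"
proof -
  let ?q = "\<lambda>x. x \<bullet> (A *v x)"
  have "continuous_on (sphere 0 1) ?q"
    by (intro continuous_intros linear_continuous_on matrix_vector_mul_bounded_linear)
  moreover have "sphere (0::real^'n) 1 \<noteq> {}"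
    using norm_axis_1[of undefined] by force
  ultimately have "\<exists>v\<in>sphere 0 1. \<forall>x\<in>sphere 0 1. ?q x \<le> ?q v"
    by (intro continuous_attains_sup compact_sphere)
  then obtain v where v: "v \<in> sphere 0 1" and max: "\<And>x. x \<in> sphere 0 1 \<Longrightarrow> ?q x \<le> ?q v"
    by blast
  define c where "c = ?q v"
  have vv: "v \<bullet> v = 1" using v by (simp add: dot_square_norm)
  have le: "?q x \<le> c * (x \<bullet> x)" for x
  proof (cases "x = 0")
    case False
    have "?q (x /\<^sub>R norm x) \<le> c" unfolding c_def by (rule max) (use False in simp)
    then have "?q x / (norm x)\<^sup>2 \<le> c"
      by (simp add: matrix_vector_mult_scaleR power2_eq_square divide_inverse mult_ac)
    then show ?thesis using False by (simp add: divide_le_eq dot_square_norm)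
  qed (simp add: matrix_vector_mult_0_right)
  \<comment> \<open>\<open>r\<close> is minus one half of the gradient of
    \<open>c * (x \<bullet> x) - ?q x\<close> at \<open>v\<close>, so a small step along
    \<open>r\<close> would push this form below 0.\<close>
  define r where "r = A *v v - c *\<^sub>R v"
  have "r = 0"
  proof (rule ccontr)
    assume "r \<noteq> 0"
    then have rr: "r \<bullet> r > 0" by simp
    \<comment> \<open>The coefficient of \<open>t * t\<close> in the expansion of that form at
      \<open>v + t *\<^sub>R r\<close>; the linear coefficient is
      \<open>- 2 * (r \<bullet> r)\<close>.\<close>
    define k where "k = c * (r \<bullet> r) - ?q r"
    have k: "k \<ge> 0" using le[of r] by (simp add: k_def)
    \<comment> \<open>This choice makes \<open>t * (k + 1)\<close> equal to
      \<open>r \<bullet> r\<close>, too small for the required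
      \<open>2 * (r \<bullet> r) \<le> t * k\<close>. The summand 1 keeps the denominator positive
      when \<open>k = 0\<close>.\<close>
    define t where "t = (r \<bullet> r) / (k + 1)"
    have t: "t > 0" using rr k by (simp add: t_def)
    have Avr: "v \<bullet> (A *v r) = (A *v v) \<bullet> r" using symmetric_matrix_inner[OF A] by simp
    have rdef: "(A *v v) \<bullet> r = r \<bullet> r + c * (v \<bullet> r)" by (simp add: r_def inner_diff_left inner_diff_right algebra_simps)
    have "?q (v + t *\<^sub>R r) \<le> c * ((v + t *\<^sub>R r) \<bullet> (v + t *\<^sub>R r))" by (rule le)
    then have "c + t * (2 * (r \<bullet> r + c * (v \<bullet> r))) + t * t * ?q r
        \<le> c * (1 + t * (2 * (v \<bullet> r)) + t * t * (r \<bullet> r))"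
      using vv
      by (simp add: matrix_vector_right_distrib matrix_vector_mult_scaleR inner_add_left inner_add_right
          Avr rdef c_def[symmetric] inner_commute[of r v] inner_commute[of r "A *v v"] algebra_simps)
    then have "t * (2 * (r \<bullet> r)) \<le> t * (t * k)"
      by (simp add: k_def algebra_simps)
    then have "2 * (r \<bullet> r) \<le> t * k" using t by simp
    also have "t * k \<le> t * (k + 1)" using t by simp
    also have "\<dots> = r \<bullet> r" using k by (simp add: t_def)
    finally show False using rr by simp
  qed
  then have "c \<in> eigenvalues A"
    using vv by (auto simp: eigenvalues_def r_def intro!: exI[of _ v])
  then show ?thesis using le by blast
qed

lemma lambda_max_ge_quadratic_form:
  fixes A :: "real^'n^'n"
  assumes A: "transpose A = A"
  shows "x \<bullet> (A *v x) \<le> lambda_max A * (x \<bullet> x)"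
proof -
  obtain c where c: "c \<in> eigenvalues A" "x \<bullet> (A *v x) \<le> c * (x \<bullet> x)"
    using symmetric_matrix_rayleigh[OF A] by blast
  have "c \<le> lambda_max A"
    unfolding lambda_max_def by (intro Max_ge finite_eigenvalues_symmetric A c)
  then show ?thesis using c(2) by (meson inner_ge_zero mult_right_mono order_trans)
qed

text \<open>Passing to \<open>- A\<close> negates both the eigenvalues and the quadratic form, which
  turns the upper Rayleigh bound into a lower one.\<close>

lemma lambda_min_le_quadratic_form:
  fixes A :: "real^'n^'n"
  assumes A: "transpose A = A"
  shows "lambda_min A * (x \<bullet> x) \<le> x \<bullet> (A *v x)"
proof -
  have neg: "(- A) *v y = - (A *v y)" for y
    by (metis diff_0 matrix_vector_mult_0 matrix_vector_mult_diff_rdistrib)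
  have "transpose (- A) = - A" using A by (simp add: transpose_def vec_eq_iff)
  then obtain c where c: "c \<in> eigenvalues (- A)" "x \<bullet> ((- A) *v x) \<le> c * (x \<bullet> x)"
    using symmetric_matrix_rayleigh by blast
  have "- c \<in> eigenvalues A"
    using c(1) by (auto simp: eigenvalues_def neg minus_equation_iff[of "A *v _"])
  then have "lambda_min A \<le> - c"
    unfolding lambda_min_def by (intro Min_le finite_eigenvalues_symmetric A)
  then have "lambda_min A * (x \<bullet> x) \<le> - c * (x \<bullet> x)" by (rule mult_right_mono) simp
  then show ?thesis using c(2) by (simp add: neg)
qed

section \<open>A trace bound for the diffusion matrix\<close>

lemma diffusion_symmetric: "transpose (diffusion g x) = diffusion g x"
  by (simp add: diffusion_def matrix_transpose_mul)

text \<open>With \<open>A = G G\<^sup>T\<close>, the trace of \<open>A B\<close> is the sum of the values of the quadratic form of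
  \<open>B\<close> at the columns of \<open>G\<close>, so \<open>A\<close> need not be diagonalized.\<close>

lemma trace_diffusion_mult_le:
  fixes g :: "real^'n \<Rightarrow> real^'m^'n" and B :: "real^'n^'n"
  assumes lam: "lam \<le> lambda_min (diffusion g x)"
    and B: "transpose B = B" and mu: "lambda_max B \<le> - mu" and "mu > 0"
  shows "trace (diffusion g x ** B) \<le> - (real CARD('n) * lam * mu)"
proof -
  have tr: "trace (diffusion g x ** B) = (\<Sum>i\<in>UNIV. column i (g x) \<bullet> (B *v column i (g x)))"
  proof -
    have "trace (diffusion g x ** B) = trace (g x ** (transpose (g x) ** B))"
      by (simp add: diffusion_def matrix_mul_assoc)
    \<comment> \<open>Cyclicity of the trace, obtained by exchanging the two summations.\<close>
    also have "\<dots> = trace ((transpose (g x) ** B) ** g x)"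
      by (simp add: trace_def matrix_matrix_mult_def mult.commute) (rule sum.swap)
    also have "\<dots> = trace (transpose (g x) ** (B ** g x))" by (simp add: matrix_mul_assoc)
    also have "\<dots> = (\<Sum>i\<in>UNIV. column i (g x) \<bullet> (B *v column i (g x)))"
      by (simp add: trace_def matrix_matrix_mult_def matrix_vector_mult_def column_def transpose_def inner_vec_def)
    finally show ?thesis .
  qed
  \<comment> \<open>Both sides are the trace of the diffusion matrix. On the right it is a sum of
    quadratic form values at unit vectors, each at least \<open>lam\<close>.\<close>
  have trD: "(\<Sum>i\<in>UNIV. column i (g x) \<bullet> column i (g x)) = (\<Sum>k\<in>UNIV. axis k 1 \<bullet> (diffusion g x *v axis k 1))"
    by (simp add: inner_axis' matrix_vector_mult_basis)
      (simp add: inner_vec_def column_def diffusion_def matrix_matrix_mult_def transpose_def, rule sum.swap)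
  have "lam \<le> axis k 1 \<bullet> (diffusion g x *v axis k 1)" for k
    using lambda_min_le_quadratic_form[OF diffusion_symmetric, of g x "axis k 1"] lam
    by (simp add: inner_axis_axis)
  then have "(\<Sum>k\<in>(UNIV::'n set). lam) \<le> (\<Sum>i\<in>UNIV. column i (g x) \<bullet> column i (g x))"
    unfolding trD by (intro sum_mono)
  then have trace_ge: "real CARD('n) * lam \<le> (\<Sum>i\<in>UNIV. column i (g x) \<bullet> column i (g x))" by simp
  have "column i (g x) \<bullet> (B *v column i (g x)) \<le> - mu * (column i (g x) \<bullet> column i (g x))" for i
    using lambda_max_ge_quadratic_form[OF B, of "column i (g x)"] mu
    by (meson inner_ge_zero mult_right_mono order_trans)
  then have "trace (diffusion g x ** B) \<le> (\<Sum>i\<in>UNIV. - mu * (column i (g x) \<bullet> column i (g x)))"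
    unfolding tr by (intro sum_mono)
  also have "\<dots> = - (mu * (\<Sum>i\<in>UNIV. column i (g x) \<bullet> column i (g x)))"
    by (simp add: sum_distrib_left sum_negf)
  also have "\<dots> \<le> - (mu * (real CARD('n) * lam))"
    using trace_ge \<open>mu > 0\<close> by simp
  finally show ?thesis by (simp add: mult_ac)
qed

section \<open>The divergence theorem with a cutoff\<close>

lemma integrable_compact_support:
  fixes u :: "real^'n \<Rightarrow> real"
  assumes "continuous_on UNIV u" "\<And>x. norm x > r \<Longrightarrow> u x = 0"
  shows "integrable lborel u"
proof -
  have "integrable lborel (\<lambda>x. indicator (cball 0 r) x *\<^sub>R u x)"
    using assms(1) by (intro borel_integrable_compact) (auto intro: continuous_on_subset)
  moreover have "(\<lambda>x. indicator (cball 0 r) x *\<^sub>R u x) = u"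
    using assms(2) by (force simp: indicator_def)
  ultimately show ?thesis by simp
qed

text \<open>The difference quotients along a coordinate direction integrate to zero because Lebesgue
  measure is translation invariant; no iterated integration is needed.\<close>

lemma integral_partial_deriv_compact_support:
  fixes u :: "real^'n \<Rightarrow> real"
  assumes u: "C1_partials u" and supp: "\<And>x. norm x > r \<Longrightarrow> u x = 0"
  shows "(\<integral>x. partial_deriv k u x \<partial>lborel) = 0"
proof -
  define e where "e i = inverse (real (Suc i))" for i
  have e: "0 < e i" "e i \<le> 1" for i by (auto simp: e_def field_simps)
  have e0: "e \<longlonglongrightarrow> 0" unfolding e_def by (rule LIMSEQ_inverse_real_of_nat)
  let ?a = "axis k 1 :: real^'n"
  define \<psi> where "\<psi> i x = (u (x + e i *\<^sub>R ?a) - u x) / e i" for i x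
  note cont = C1_partialsD(2)[OF u] C1_partialsD(3)[OF u, of k]
  have meas: "u \<in> borel_measurable lborel" "partial_deriv k u \<in> borel_measurable lborel"
    using cont by (auto intro: borel_measurable_continuous_onI)
  have int: "integrable lborel u"
    using cont(1) supp by (rule integrable_compact_support)
  have shift: "integrable lborel (\<lambda>x. u (x + c))" "(\<integral>x. u (x + c) \<partial>lborel) = (\<integral>x. u x \<partial>lborel)" for c
  proof -
    have "integrable (distr lborel borel ((+) c)) u" using int by (simp add: lborel_distr_plus)
    then show "integrable lborel (\<lambda>x. u (x + c))"
      by (subst (asm) integrable_distr_eq) (use meas in \<open>auto simp: add.commute\<close>)
    have "(\<integral>x. u x \<partial>lborel) = (\<integral>x. u x \<partial>distr lborel borel ((+) c))" by (simp add: lborel_distr_plus)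
    also have "\<dots> = (\<integral>x. u (x + c) \<partial>lborel)"
      by (subst integral_distr) (use meas in \<open>auto simp: add.commute\<close>)
    finally show "(\<integral>x. u (x + c) \<partial>lborel) = (\<integral>x. u x \<partial>lborel)" by simp
  qed
  have zero: "(\<integral>x. \<psi> i x \<partial>lborel) = 0" for i
    unfolding \<psi>_def using shift int by simp
  \<comment> \<open>The mean value theorem evaluates the partial derivative at
    \<open>x + s *\<^sub>R ?a\<close> with \<open>s < 1\<close>, and only points with
    \<open>norm x \<le> r + 1\<close> matter; hence the radius \<open>r + 2\<close>.\<close>
  obtain M where M: "\<And>y. y \<in> cball 0 (r + 2) \<Longrightarrow> \<bar>partial_deriv k u y\<bar> \<le> M"
  proof -
    have "compact (partial_deriv k u ` cball 0 (r + 2))"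
      using cont(2) by (intro compact_continuous_image) (auto intro: continuous_on_subset)
    then have "bounded (partial_deriv k u ` cball 0 (r + 2))" by (rule compact_imp_bounded)
    then show ?thesis
      using that unfolding bounded_iff by (metis imageI real_norm_def)
  qed
  \<comment> \<open>Shifts have length at most 1, so all difference quotients vanish beyond radius
    \<open>r + 1\<close>.\<close>
  let ?w = "\<lambda>x. indicator (cball 0 (r + 1)) x *\<^sub>R M"
  have "(\<lambda>i. \<integral>x. \<psi> i x \<partial>lborel) \<longlonglongrightarrow> (\<integral>x. partial_deriv k u x \<partial>lborel)"
  proof (rule integral_dominated_convergence)
    show "integrable lborel ?w"
      by (intro borel_integrable_compact continuous_intros) auto
    show "\<psi> i \<in> borel_measurable lborel" for i
      using shift(1)[of "e i *\<^sub>R ?a"] meas(1) unfolding \<psi>_def by (auto dest: borel_measurable_integrable)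
    show "AE x in lborel. (\<lambda>i. \<psi> i x) \<longlonglongrightarrow> partial_deriv k u x"
    proof (rule AE_I2)
      fix x
      have "(\<lambda>h. (u (x + h *\<^sub>R ?a) - u x) / h) \<midarrow>0\<rightarrow> partial_deriv k u x"
        using has_real_derivative_along_axis[of u x 0 k] C1_partialsD(1)[OF u]
        by (simp add: has_field_derivative_iff)
      moreover have "filterlim e (at 0) sequentially"
        using e0 e(1) by (simp add: filterlim_at eventually_sequentially less_imp_neq[symmetric])
      ultimately show "(\<lambda>i. \<psi> i x) \<longlonglongrightarrow> partial_deriv k u x"
        unfolding \<psi>_def by (rule filterlim_compose)
    qed
    show "AE x in lborel. norm (\<psi> i x) \<le> ?w x" for i
    proof (rule AE_I2)
      fix x
      have tri: "norm x \<le> norm (x + s *\<^sub>R ?a) + s" "norm (x + s *\<^sub>R ?a) \<le> norm x + s" if "s \<ge> 0" for s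
        using norm_triangle_ineq4[of "x + s *\<^sub>R ?a" "s *\<^sub>R ?a"] norm_triangle_ineq[of x "s *\<^sub>R ?a"] that by auto
      show "norm (\<psi> i x) \<le> ?w x"
      proof (cases "norm x \<le> r + 1")
        case True
        obtain s where s: "0 < s" "s < e i" "u (x + e i *\<^sub>R ?a) - u x = e i * partial_deriv k u (x + s *\<^sub>R ?a)"
          using partial_deriv_mvt[OF C1_partialsD(1)[OF u] e(1)] by metis
        have "x + s *\<^sub>R ?a \<in> cball 0 (r + 2)" using tri(2)[of s] s e(2)[of i] True by simp
        then show ?thesis using M s(3) e(1)[of i] True by (simp add: \<psi>_def)
      next
        case False
        then have "u x = 0" "u (x + e i *\<^sub>R ?a) = 0"
          using tri(1)[of "e i"] e[of i] by (auto intro!: supp)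
        then show ?thesis using False by (simp add: \<psi>_def)
      qed
    qed
  qed (use meas in simp)
  then show ?thesis by (simp add: zero LIMSEQ_const_iff)
qed

section \<open>A continuously differentiable radial cutoff\<close>

definition pos_square :: "real \<Rightarrow> real" where
  "pos_square t = (max 0 t)\<^sup>2"

lemma pos_square_has_real_derivative:
  "(pos_square has_real_derivative 2 * max 0 t) (at t)"
proof -
  consider "t < 0" | "t > 0" | "t = 0" by linarith
  then show ?thesis
  proof cases
    case 1
    have "((\<lambda>_. 0) has_real_derivative 2 * max 0 t) (at t)" using 1 by simp
    then show ?thesis
      by (rule has_field_derivative_transform_within_open[of _ _ _ "{..<0}"])
         (use 1 in \<open>auto simp: pos_square_def\<close>)
  next
    case 2
    have "((\<lambda>s. s\<^sup>2) has_real_derivative 2 * max 0 t) (at t)"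
      using 2 by (auto intro!: derivative_eq_intros)
    then show ?thesis
      by (rule has_field_derivative_transform_within_open[of _ _ _ "{0<..}"])
         (use 2 in \<open>auto simp: pos_square_def\<close>)
  next
    case 3
    have "(\<lambda>h. max 0 h) \<midarrow>0\<rightarrow> (0::real)"
      by (rule tendsto_eq_intros tendsto_max tendsto_const tendsto_ident_at)+ simp
    moreover have "pos_square h / h = max 0 h" for h
      by (simp add: pos_square_def power2_eq_square max_def)
    ultimately show ?thesis
      using 3 by (simp add: DERIV_def pos_square_def[of 0])
  qed
qed

lemma continuous_on_pos_square [continuous_intros]:
  "continuous_on S h \<Longrightarrow> continuous_on S (\<lambda>x. pos_square (h x))"
  unfolding pos_square_def by (intro continuous_intros)

text \<open>The inner \<open>pos_square\<close> is 0 up to \<open>norm x = R\<close> and reaches 1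
  when \<open>x \<bullet> x = 2 * R\<^sup>2\<close>, where the outer one becomes 0; this lies inside
  radius \<open>2 * R\<close>. Using \<open>x \<bullet> x\<close> instead of the norm avoids the
  kink at the origin.\<close>

definition cutoff :: "real \<Rightarrow> real^'n \<Rightarrow> real" where
  "cutoff R x = pos_square (1 - pos_square (x \<bullet> x / R\<^sup>2 - 1))"

lemma cutoff_range: "0 \<le> cutoff R x" "cutoff R x \<le> 1"
  by (auto simp: cutoff_def pos_square_def intro!: power_le_one)

lemma cutoff_eq_1: "R > 0 \<Longrightarrow> norm x \<le> R \<Longrightarrow> cutoff R x = 1"
  by (simp add: cutoff_def pos_square_def max_def dot_square_norm divide_le_eq_1 power_mono)

lemma inner_div_square_ge:
  assumes "R > 0" "2 * R \<le> norm (x::real^'n)"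
  shows "2 \<le> x \<bullet> x / R\<^sup>2"
proof -
  have "2 * R\<^sup>2 \<le> (2 * R)\<^sup>2" by (simp add: power_mult_distrib)
  also have "\<dots> \<le> (norm x)\<^sup>2" using assms by (intro power_mono) auto
  finally show ?thesis using assms(1) by (simp add: dot_square_norm le_divide_eq)
qed

lemma cutoff_eq_0:
  assumes "R > 0" "2 * R \<le> norm x"
  shows "cutoff R x = 0"
proof -
  have "1 \<le> pos_square (x \<bullet> x / R\<^sup>2 - 1)"
    using inner_div_square_ge[OF assms] unfolding pos_square_def by (intro one_le_power) auto
  then show ?thesis by (simp add: cutoff_def pos_square_def[of "1 - _"])
qed

lemma cutoff_partials:
  fixes x :: "real^'n"
  assumes R: "R > 0"
  shows "C1_partials (cutoff R :: real^'n \<Rightarrow> real)"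
    and "partial_deriv k (cutoff R) x =
      - (4 * max 0 (1 - pos_square (x \<bullet> x / R\<^sup>2 - 1)) * max 0 (x \<bullet> x / R\<^sup>2 - 1)) * (2 * x $ k / R\<^sup>2)"
proof -
  let ?F = "\<lambda>s. pos_square (1 - pos_square (s - 1))"
  let ?F' = "\<lambda>s. - (4 * max 0 (1 - pos_square (s - 1)) * max 0 (s - 1))"
  let ?s = "\<lambda>x::real^'n. x \<bullet> x / R\<^sup>2"
  have ds: "(?s has_derivative (\<lambda>v. 2 * (y \<bullet> v) / R\<^sup>2)) (at y)" for y
    by (rule has_derivative_eq_rhs[OF bounded_linear.has_derivative[OF bounded_linear_divide
        has_derivative_inner[OF has_derivative_ident has_derivative_ident]]])
      (simp add: inner_commute)
  have ps: "partial_deriv k ?s = (\<lambda>y. 2 * y $ k / R\<^sup>2)" for k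
    using partial_deriv_eq[OF ds] by (auto simp: inner_axis)
  have s: "C1_partials ?s"
    using ds R by (auto simp: C1_partials_def ps differentiable_def intro!: continuous_intros)
  have dF: "(?F has_real_derivative ?F' t) (at t)" for t
    by (rule DERIV_cong, rule DERIV_chain2[OF pos_square_has_real_derivative],
        rule DERIV_diff[OF DERIV_const], rule DERIV_chain2[OF pos_square_has_real_derivative])
       (auto intro!: derivative_eq_intros)
  have "C1_partials (\<lambda>x. ?F (?s x))"
    using s dF by (rule C1_partials_compose) (intro continuous_intros C1_partialsD(2)[OF s])
  then show "C1_partials (cutoff R :: real^'n \<Rightarrow> real)" by (simp add: cutoff_def[abs_def])
  show "partial_deriv k (cutoff R) x = ?F' (?s x) * (2 * x $ k / R\<^sup>2)"
    using partial_deriv_compose(2)[OF C1_partialsD(1)[OF s] dF] by (simp add: cutoff_def[abs_def] ps)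
qed

text \<open>One of the two \<open>max\<close> factors in the gradient formula vanishes on each side
  of the shell: the second inside it, the first outside.\<close>

lemma partial_deriv_cutoff_eq_0:
  assumes R: "R > 0" and x: "norm x \<le> R \<or> 2 * R \<le> norm x"
  shows "partial_deriv k (cutoff R) x = 0"
  using x
proof
  assume "norm x \<le> R"
  then have "x \<bullet> x / R\<^sup>2 \<le> 1" using R by (simp add: dot_square_norm divide_le_eq_1 power_mono)
  then show ?thesis by (simp add: cutoff_partials(2)[OF R])
next
  assume "2 * R \<le> norm x"
  then have "1 \<le> pos_square (x \<bullet> x / R\<^sup>2 - 1)"
    using inner_div_square_ge[OF R] unfolding pos_square_def by (intro one_le_power) force
  then show ?thesis by (simp add: cutoff_partials(2)[OF R])
qed

text \<open>On the shell the profile contributes a factor of at most 4, and the derivative of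
  \<open>x \<bullet> x / R\<^sup>2\<close> at most \<open>2 * (2 * R) / R\<^sup>2\<close>; their
  product is \<open>16 / R\<close>.\<close>

lemma abs_partial_deriv_cutoff_le:
  assumes R: "R > 0"
  shows "\<bar>partial_deriv k (cutoff R) x\<bar> \<le> 16 / R"
proof (cases "norm x \<le> R \<or> 2 * R \<le> norm x")
  case False
  define a where "a = max 0 (1 - pos_square (x \<bullet> x / R\<^sup>2 - 1))"
  define b where "b = max 0 (x \<bullet> x / R\<^sup>2 - 1)"
  have a: "0 \<le> a" "a \<le> 1" "a = max 0 (1 - b\<^sup>2)" by (auto simp: a_def b_def pos_square_def)
  have b: "0 \<le> b" by (simp add: b_def)
  \<comment> \<open>For \<open>b > 1\<close> the factor \<open>a\<close> vanishes; otherwise both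
    factors are at most 1.\<close>
  have ab: "a * b \<le> 1"
  proof (cases "b \<le> 1")
    case True then show ?thesis using a b by (simp add: mult_le_one)
  next
    case False
    then have "1 \<le> b\<^sup>2" by (intro one_le_power) auto
    then show ?thesis using a by simp
  qed
  have xk: "\<bar>x $ k\<bar> \<le> 2 * R" using component_le_norm_cart[of x k] False by linarith
  have "\<bar>partial_deriv k (cutoff R) x\<bar> = (4 * (a * b)) * (2 * \<bar>x $ k\<bar> / R\<^sup>2)"
    unfolding cutoff_partials(2)[OF R] a_def[symmetric] b_def[symmetric] using a b
    by (simp add: abs_mult)
  also have "\<dots> \<le> (4 * 1) * (2 * (2 * R) / R\<^sup>2)"
    using ab xk a b by (intro mult_mono divide_right_mono) auto
  also have "\<dots> = 16 / R" using R by (simp add: power2_eq_square)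
  finally show ?thesis .
qed (use partial_deriv_cutoff_eq_0[OF R, of x k] R in auto)

section \<open>Integration by parts against the cutoff and removal of the cutoff\<close>

lemma integrable_cutoff_mult:
  fixes u :: "real^'n \<Rightarrow> real"
  assumes R: "R > 0" and u: "continuous_on UNIV u"
  shows "integrable lborel (\<lambda>x. cutoff R x * u x)"
  by (rule integrable_compact_support[of _ "2 * R"])
    (use R in \<open>auto intro!: continuous_on_mult u C1_partialsD(2)[OF cutoff_partials(1)] simp: cutoff_eq_0\<close>)

lemma integrable_partial_deriv_cutoff_mult:
  fixes u :: "real^'n \<Rightarrow> real"
  assumes R: "R > 0" and u: "continuous_on UNIV u"
  shows "integrable lborel (\<lambda>x. partial_deriv k (cutoff R) x * u x)"
  by (rule integrable_compact_support[of _ "2 * R"])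
    (use R in \<open>auto intro!: continuous_on_mult u C1_partialsD(3)[OF cutoff_partials(1)]
      simp: partial_deriv_cutoff_eq_0\<close>)

text \<open>Each product of the cutoff with a component of \<open>H\<close> is C1 with compact
  support, so its partial derivative integrates to 0; the product rule splits that integral.\<close>

lemma integral_cutoff_div_vec:
  fixes H :: "real^'n \<Rightarrow> real^'n"
  assumes H: "\<And>k. C1_partials (\<lambda>x. H x $ k)" and R: "R > 0"
  shows "(\<integral>x. cutoff R x * div_vec H x \<partial>lborel)
    = - (\<integral>x. (\<Sum>k\<in>UNIV. partial_deriv k (cutoff R) x * H x $ k) \<partial>lborel)"
proof -
  note chi = cutoff_partials(1)[OF R, where 'n = 'n]
  let ?P = "\<lambda>k. partial_deriv k (\<lambda>y. cutoff R y * H y $ k)"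
  have P: "?P k x = partial_deriv k (cutoff R) x * H x $ k + cutoff R x * partial_deriv k (\<lambda>y. H y $ k) x" for k x
    by (intro partial_deriv_mult C1_partialsD(1) chi H)
  note int1 = integrable_partial_deriv_cutoff_mult[OF R C1_partialsD(2)[OF H]]
  note int2 = integrable_cutoff_mult[OF R C1_partialsD(3)[OF H]]
  have zero: "(\<integral>x. ?P k x \<partial>lborel) = 0" for k
    by (rule integral_partial_deriv_compact_support[of _ "2 * R"])
       (auto intro!: C1_partials_mult chi H simp: cutoff_eq_0[OF R])
  have "(\<integral>x. cutoff R x * div_vec H x \<partial>lborel)
      = (\<Sum>k\<in>UNIV. \<integral>x. cutoff R x * partial_deriv k (\<lambda>y. H y $ k) x \<partial>lborel)"
    by (simp add: div_vec_def sum_distrib_left int2)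
  also have "\<dots> = (\<Sum>k\<in>UNIV. - (\<integral>x. partial_deriv k (cutoff R) x * H x $ k \<partial>lborel))"
  proof (rule sum.cong[OF refl])
    fix k
    have "(\<integral>x. partial_deriv k (cutoff R) x * H x $ k \<partial>lborel)
        + (\<integral>x. cutoff R x * partial_deriv k (\<lambda>y. H y $ k) x \<partial>lborel) = 0"
      using zero[of k] int1 int2 by (simp add: P)
    then show "(\<integral>x. cutoff R x * partial_deriv k (\<lambda>y. H y $ k) x \<partial>lborel)
        = - (\<integral>x. partial_deriv k (cutoff R) x * H x $ k \<partial>lborel)"
      by linarith
  qed
  finally show ?thesis by (simp add: sum_negf int1)
qed

text \<open>The gradient of the cutoff is of order \<open>1 / R\<close> on a shell of volume of order \<open>R ^ n\<close>, where
  \<open>H = o(R powr (1 - n))\<close>.\<close>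

lemma integral_cutoff_div_vec_tendsto_0:
  fixes H :: "real^'n \<Rightarrow> real^'n"
  assumes H: "\<And>k. C1_partials (\<lambda>x. H x $ k)"
    and decay: "(\<lambda>x. norm (H x)) \<in> o[at_infinity](\<lambda>x. norm x powr (1 - real CARD('n)))"
  shows "(\<lambda>i. \<integral>x. cutoff (real (Suc i)) x * div_vec H x \<partial>lborel) \<longlonglongrightarrow> 0"
proof -
  let ?n = "CARD('n)"
  \<comment> \<open>\<open>?n\<close> components, the gradient constant 16, and the volume of the
    ball of radius \<open>2 * R\<close> without its factor \<open>R ^ ?n\<close>. The powers of
    \<open>R\<close> cancel in the final estimate.\<close>
  define C where "C = 16 * real ?n * unit_ball_vol (real ?n) * 2 ^ ?n"
  have C: "C > 0" by (simp add: C_def)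
  have bound: "\<bar>\<integral>x. cutoff R x * div_vec H x \<partial>lborel\<bar> \<le> C * \<epsilon>"
    if R: "R > 0" and eps: "\<epsilon> > 0" and le: "\<And>x. R \<le> norm x \<Longrightarrow> norm (H x) \<le> \<epsilon> * norm x powr (1 - real ?n)"
    for R \<epsilon>
  proof -
    let ?S = "\<lambda>x. \<Sum>k\<in>UNIV. partial_deriv k (cutoff R) x * H x $ k"
    let ?B = "real ?n * (16 / R * (\<epsilon> * R powr (1 - real ?n)))"
    have summand: "\<bar>partial_deriv k (cutoff R) x * H x $ k\<bar> \<le> 16 / R * (\<epsilon> * R powr (1 - real ?n))" for x k
    proof (cases "norm x \<le> R")
      case False
      have "\<bar>H x $ k\<bar> \<le> norm (H x)" by (rule component_le_norm_cart)
      also have "\<dots> \<le> \<epsilon> * norm x powr (1 - real ?n)" using False by (intro le) simp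
      \<comment> \<open>The exponent \<open>1 - real ?n\<close> is nonpositive, so the power
        decreases in the radius.\<close>
      also have "\<dots> \<le> \<epsilon> * R powr (1 - real ?n)"
        using False R eps by (intro mult_left_mono powr_mono2') auto
      finally show ?thesis
        unfolding abs_mult using R by (intro mult_mono abs_partial_deriv_cutoff_le) auto
    qed (use R eps in \<open>simp add: partial_deriv_cutoff_eq_0\<close>)
    have S: "\<bar>?S x\<bar> \<le> indicator (cball 0 (2 * R)) x *\<^sub>R ?B" for x :: "real^'n"
    proof (cases "norm x \<le> 2 * R")
      case True
      have "\<bar>?S x\<bar> \<le> (\<Sum>k\<in>(UNIV::'n set). 16 / R * (\<epsilon> * R powr (1 - real ?n)))"
        by (rule order_trans[OF sum_abs sum_mono[OF summand]])
      then show ?thesis using True by simp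
    qed (use R in \<open>simp add: partial_deriv_cutoff_eq_0\<close>)
    have int: "integrable lborel (\<lambda>x::real^'n. indicator (cball 0 (2 * R)) x *\<^sub>R ?B)"
      by (intro borel_integrable_compact continuous_intros) auto
    have "\<bar>\<integral>x. cutoff R x * div_vec H x \<partial>lborel\<bar> = \<bar>\<integral>x. ?S x \<partial>lborel\<bar>"
      by (simp add: integral_cutoff_div_vec[OF H R])
    also have "\<dots> \<le> (\<integral>x. indicator (cball (0::real^'n) (2 * R)) x *\<^sub>R ?B \<partial>lborel)"
    proof (rule Bochner_Integration.integral_abs_bound_integral[OF _ int S])
      show "integrable lborel ?S"
        by (intro Bochner_Integration.integrable_sum integrable_partial_deriv_cutoff_mult R
            C1_partialsD(2)[OF H])
    qed
    also have "\<dots> = unit_ball_vol (real ?n) * (2 * R) ^ ?n * ?B"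
      using R by (simp add: content_cball)
    also have "\<dots> = C * \<epsilon> * (R ^ ?n * R powr (1 - real ?n) / R)"
      by (simp add: C_def power_mult_distrib)
    also have "R ^ ?n * R powr (1 - real ?n) / R = 1"
      using R by (simp add: powr_diff powr_realpow)
    finally show ?thesis by simp
  qed
  show ?thesis
  proof (rule LIMSEQ_I)
    fix \<eta> :: real assume "\<eta> > 0"
    define \<epsilon> where "\<epsilon> = \<eta> / (2 * C)"
    have eps: "\<epsilon> > 0" using \<open>\<eta> > 0\<close> C by (simp add: \<epsilon>_def)
    obtain b where b: "\<And>x. b \<le> norm x \<Longrightarrow> norm (H x) \<le> \<epsilon> * norm x powr (1 - real ?n)"
      using landau_o.smallD[OF decay eps] by (auto simp: eventually_at_infinity)
    obtain N where N: "b \<le> real N" using real_arch_simple by blast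
    have "norm ((\<integral>x. cutoff (real (Suc i)) x * div_vec H x \<partial>lborel) - 0) < \<eta>" if "i \<ge> N" for i
    proof -
      have "\<bar>\<integral>x. cutoff (real (Suc i)) x * div_vec H x \<partial>lborel\<bar> \<le> C * \<epsilon>"
        using that N by (intro bound eps b) auto
      also have "\<dots> < \<eta>" using \<open>\<eta> > 0\<close> C by (simp add: \<epsilon>_def)
      finally show ?thesis by simp
    qed
    then show "\<exists>N. \<forall>i\<ge>N. norm ((\<integral>x. cutoff (real (Suc i)) x * div_vec H x \<partial>lborel) - 0) < \<eta>" by blast
  qed
qed

text \<open>At each point the cutoff is eventually 1, and \<open>\<bar>u x\<bar>\<close> dominates.
  The radii start at \<open>Suc 0\<close>, so they are always positive.\<close>

lemma integral_cutoff_tendsto: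
  fixes u :: "real^'n \<Rightarrow> real"
  assumes u: "integrable lborel u"
  shows "(\<lambda>i. \<integral>x. cutoff (real (Suc i)) x * u x \<partial>lborel) \<longlonglongrightarrow> (\<integral>x. u x \<partial>lborel)"
proof (rule integral_dominated_convergence)
  show "integrable lborel (\<lambda>x. \<bar>u x\<bar>)" using u by simp
  have "cutoff (real (Suc i)) \<in> borel_measurable (lborel :: (real^'n) measure)" for i
    using borel_measurable_continuous_onI[OF C1_partialsD(2)[OF cutoff_partials(1)[where 'n = 'n]], of "real (Suc i)"]
    by simp
  then show "(\<lambda>x. cutoff (real (Suc i)) x * u x) \<in> borel_measurable lborel" for i
    using borel_measurable_integrable[OF u] by (rule borel_measurable_times)
  show "AE x in lborel. norm (cutoff (real (Suc i)) x * u x) \<le> \<bar>u x\<bar>" for i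
    by (rule AE_I2) (simp add: abs_mult cutoff_range mult_left_le_one_le)
  show "AE x in lborel. (\<lambda>i. cutoff (real (Suc i)) x * u x) \<longlonglongrightarrow> u x"
  proof (rule AE_I2, rule tendsto_eventually)
    fix x :: "real^'n"
    obtain N where N: "norm x \<le> real N" using real_arch_simple by blast
    show "\<forall>\<^sub>F i in sequentially. cutoff (real (Suc i)) x * u x = u x"
      using eventually_ge_at_top[of N]
    proof eventually_elim
      case (elim i)
      then have "norm x \<le> real (Suc i)" using N by linarith
      then show ?case by (simp add: cutoff_eq_1)
    qed
  qed
qed (rule borel_measurable_integrable[OF u])

section \<open>Green's identity and the dissipation inequality\<close>

text \<open>The vector field of the decay condition is the flux in Green's identity for the generator and
  its adjoint. The second-order terms cancel in pairs because \<open>G\<close> is symmetric.\<close>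

lemma greens_identity:
  fixes f :: "real^'n \<Rightarrow> real^'n" and G :: "real^'n \<Rightarrow> real^'n^'n"
  assumes f: "\<And>j. C1_partials (\<lambda>x. f x $ j)"
    and G: "\<And>j k. C2_partials (\<lambda>x. G x $ j $ k)" and sym: "\<And>x. transpose (G x) = G x"
    and u: "C2_partials u" and v: "C2_partials v"
  defines "H \<equiv> \<lambda>x. (u x * v x) *\<^sub>R (f x - (1/2) *\<^sub>R div_mat G x)
      + (1/2) *\<^sub>R (G x *v (u x *\<^sub>R grad v x - v x *\<^sub>R grad u x))"
  shows "C1_partials (\<lambda>x. H x $ j)"
    and "div_vec H x = u x * generator f G v x - v x * adjoint_generator f G u x"
proof -
  define d where "d j k = (\<lambda>x. G x $ j $ k)" for j k
  have d_sym: "d j k = d k j" for j k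
    unfolding d_def by (rule ext) (metis sym transpose_def vec_lambda_beta)
  define F where "F j = (\<lambda>x. f x $ j)" for j
  \<comment> \<open>All that \<open>G\<close> contributes to component \<open>j\<close> of the flux
    through its entry \<open>(j, k)\<close>, from both the \<open>div_mat\<close> term and the
    gradient term.\<close>
  define T where "T j k = (\<lambda>x. 1/2 * (d j k x * (u x * partial_deriv k v x - v x * partial_deriv k u x)
      - u x * v x * partial_deriv k (d j k) x))" for j k
  have C2: "C2_partials (d j k)" for j k using G by (simp add: d_def)
  have C1: "C1_partials u" "C1_partials v" "C1_partials (partial_deriv k u)" "C1_partials (partial_deriv k v)"
    "C1_partials (F j)" "C1_partials (d j k)" "C1_partials (partial_deriv i (d j k))" for i j k
    using u v C2 f by (auto dest: C2_partialsD simp: F_def)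
  note diff = C1[THEN C1_partialsD(1)]
  have T: "C1_partials (T j k)" for j k
    unfolding T_def by (intro C1_partials_mult C1_partials_diff C1_partials_const C1)
  have H: "(\<lambda>x. H x $ j) = (\<lambda>x. u x * v x * F j x + (\<Sum>k\<in>UNIV. T j k x))" for j
    by (rule ext) (simp add: H_def T_def F_def d_def div_mat_def grad_def matrix_vector_mult_def
        right_diff_distrib sum_subtractf sum_distrib_left mult_ac)
  have uvF: "C1_partials (\<lambda>x. u x * v x * F j x)" for j
    by (intro C1_partials_mult C1)
  show "C1_partials (\<lambda>x. H x $ j)" for j
    unfolding H by (intro C1_partials_add C1_partials_sum uvF T)
  define b where "b j k = 1/2 * (partial_deriv j (d j k) x * u x * partial_deriv k v x
      + d j k x * partial_deriv j u x * partial_deriv k v x)" for j k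
  have pud: "partial_deriv k (\<lambda>y. u y * d j k y) = (\<lambda>y. partial_deriv k u y * d j k y + u y * partial_deriv k (d j k) y)" for j k
    using diff by (auto simp: partial_deriv_mult)
  have dT: "partial_deriv j (T j k) x = 1/2 * (u x * d j k x * partial_deriv j (partial_deriv k v) x)
      - 1/2 * (v x * partial_deriv j (partial_deriv k (\<lambda>y. u y * d j k y)) x) + (b j k - b k j)" for j k
    unfolding pud T_def b_def d_sym[of k j]
    by (simp only: partial_deriv_mult partial_deriv_diff partial_deriv_add partial_deriv_const diff
        differentiable_add differentiable_diff differentiable_mult differentiable_const)
      (simp add: field_simps)
  \<comment> \<open>The product rule grouped so that the first term feeds the generator of
    \<open>v\<close> and the second the divergence in the adjoint of \<open>u\<close>.\<close>
  have dF: "partial_deriv j (\<lambda>x. u x * v x * F j x) x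
      = u x * (F j x * partial_deriv j v x) + v x * partial_deriv j (\<lambda>y. u y * F j y) x" for j
    by (simp add: partial_deriv_mult diff algebra_simps)
  have anti: "(\<Sum>j\<in>UNIV. \<Sum>k\<in>UNIV. b j k - b k j) = 0"
    using sum.swap[of b UNIV UNIV] by (simp add: sum_subtractf)
  have "div_vec H x = (\<Sum>j\<in>UNIV. partial_deriv j (\<lambda>x. u x * v x * F j x) x + (\<Sum>k\<in>UNIV. partial_deriv j (T j k) x))"
    unfolding div_vec_def H using uvF T
    by (simp add: partial_deriv_add C1_partialsD(1) C1_partials_sum partial_deriv_sum)
  also have "\<dots> = u x * (\<Sum>j\<in>UNIV. F j x * partial_deriv j v x)
      + v x * (\<Sum>j\<in>UNIV. partial_deriv j (\<lambda>y. u y * F j y) x)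
      + 1/2 * (u x * (\<Sum>j\<in>UNIV. \<Sum>k\<in>UNIV. d j k x * partial_deriv j (partial_deriv k v) x))
      - 1/2 * (v x * (\<Sum>j\<in>UNIV. \<Sum>k\<in>UNIV. partial_deriv j (partial_deriv k (\<lambda>y. u y * d j k y)) x))
      + (\<Sum>j\<in>UNIV. \<Sum>k\<in>UNIV. b j k - b k j)"
    unfolding dT dF by (simp add: sum.distrib sum_subtractf sum_distrib_left mult_ac)
  also have "\<dots> = u x * generator f G v x - v x * adjoint_generator f G u x"
  proof -
    have "f x \<bullet> grad v x = (\<Sum>j\<in>UNIV. F j x * partial_deriv j v x)"
      by (simp add: F_def grad_def inner_vec_def)
    moreover have "div_vec (\<lambda>y. u y *\<^sub>R f y) x = (\<Sum>j\<in>UNIV. partial_deriv j (\<lambda>y. u y * F j y) x)"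
      by (simp add: F_def div_vec_def)
    \<comment> \<open>The matrix product produces the Hessian entry with indices \<open>k j\<close>;
      commuting the partials restores the order \<open>j k\<close>.\<close>
    moreover have "trace (G x ** hessian v x) = (\<Sum>j\<in>UNIV. \<Sum>k\<in>UNIV. d j k x * partial_deriv j (partial_deriv k v) x)"
      by (simp add: trace_def matrix_matrix_mult_def hessian_def d_def partial_deriv_commute[OF v])
    moreover have "div2 (\<lambda>y. u y *\<^sub>R G y) x
        = (\<Sum>j\<in>UNIV. \<Sum>k\<in>UNIV. partial_deriv j (partial_deriv k (\<lambda>y. u y * d j k y)) x)"
      by (simp add: div2_def d_def)
    ultimately show ?thesis
      unfolding generator_def adjoint_generator_def anti by (simp add: algebra_simps)
  qed
  finally show "div_vec H x = u x * generator f G v x - v x * adjoint_generator f G u x" .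
qed

text \<open>Green's identity turns decay of the flux into a statement about generators. It serves
  twice: for \<open>p\<close> and \<open>ln p\<close> with the diffusion matrix, and for 1 and
  \<open>p\<close> with the zero matrix.\<close>

lemma decaying_integral_tendsto_0:
  fixes f :: "real^'n \<Rightarrow> real^'n" and G :: "real^'n \<Rightarrow> real^'n^'n"
  assumes "\<And>j. C1_partials (\<lambda>x. f x $ j)"
    and "\<And>j k. C2_partials (\<lambda>x. G x $ j $ k)" "\<And>x. transpose (G x) = G x"
    and "C2_partials u" "C2_partials v"
    and "decaying f G u v"
  shows "(\<lambda>i. \<integral>x. cutoff (real (Suc i)) x * (u x * generator f G v x - v x * adjoint_generator f G u x) \<partial>lborel)
    \<longlonglongrightarrow> 0"
  using integral_cutoff_div_vec_tendsto_0[OF greens_identity(1)[OF assms(1-5)] assms(6)[unfolded decaying_def]]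
  unfolding greens_identity(2)[OF assms(1-5)] .

section \<open>Regularity of the coefficients and the dissipation inequality\<close>

lemma C2_partials_diffusion:
  fixes g :: "real^'n \<Rightarrow> real^'m^'n"
  assumes "C2 g"
  shows "C2_partials (\<lambda>x. diffusion g x $ j $ k)"
proof -
  have "bounded_linear (\<lambda>A :: real^'m^'n. A $ i $ l)" for i l
    by (rule bounded_linear_compose[OF bounded_linear_vec_nth bounded_linear_vec_nth])
  then have "C2_partials (\<lambda>x. g x $ i $ l)" for i l
    by (rule C2_imp_C2_partials[OF C2_bounded_linear[OF assms]])
  then show ?thesis
    unfolding diffusion_def matrix_matrix_mult_def transpose_def
    by (simp add: C2_partials_sum C2_partials_mult)
qed

lemma transpose_hessian:
  "C2_partials h \<Longrightarrow> transpose (hessian h x) = hessian h x"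
  by (simp add: transpose_def hessian_def vec_eq_iff partial_deriv_commute)

text \<open>Division by zero yields 0, so for a vanishing expectation the inequality alone would say
  only \<open>K \<ge> 0\<close>; the first conjunct excludes this. Infimum and supremum are taken in
  \<open>ereal\<close>, where equality with a real number also expresses that they are
  finite.\<close>

theorem lemma8:
  fixes f :: "real^'n \<Rightarrow> real^'n"
    and g :: "real^'n \<Rightarrow> real^'m^'n"
    and D :: "real^'n \<Rightarrow> real^'n^'n"
    and p :: "real^'n \<Rightarrow> real"
    and lam mu K :: real
  assumes f_C1: "C1 f" and f_lipschitz: "\<exists>L. L-lipschitz_on UNIV f"
    and g_C2: "C2 g" and g_lipschitz: "\<exists>L. L-lipschitz_on UNIV g"
    and D_eq: "D = diffusion g"
    and p_invariant: "invariant_density f D p"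
    and p_unique: "\<And>q. invariant_density f D q \<Longrightarrow> q = p"
    and p_pos: "\<And>x. p x > 0"
    and lam_eq: "ereal lam = (INF x. ereal (lambda_min (D x)))"
    and lam_pos: "lam > 0"
    and mu_eq: "ereal mu = - (SUP x. ereal (lambda_max (hessian (\<lambda>y. ln (p y)) x)))"
    and mu_pos: "mu > 0"
    and gen_finite: "expect_abs p (generator f D (\<lambda>y. ln (p y))) < \<infinity>"
    and div_finite: "expect_abs p (div_vec f) < \<infinity>"
    and decay_log: "decaying f D p (\<lambda>y. ln (p y))"
    and decay_one: "decaying f (\<lambda>_. 0) (\<lambda>_. 1) p"
    and K_eq: "K = 1 / (lam * mu)"
  shows "expect p (div_vec f) \<noteq> 0 \<and> K \<ge> - (real CARD('n) / (2 * expect p (div_vec f)))"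
proof -
  let ?w = "\<lambda>y. ln (p y)"
  let ?n = "real CARD('n)"
  have f: "C1_partials (\<lambda>x. f x $ j)" for j
    by (rule C1_imp_C1_partials[OF C1_bounded_linear[OF f_C1 bounded_linear_vec_nth]])
  have p: "C2_partials p" and p_mass: "(\<integral>\<^sup>+x. ennreal (p x) \<partial>lborel) = 1"
    and p_adj: "adjoint_generator f D p x = 0" for x
    using p_invariant by (auto simp: invariant_density_def C2_imp_C2_partials)
  have w: "C2_partials ?w" using p p_pos by (rule C2_partials_ln)
  have D: "C2_partials (\<lambda>x. D x $ j $ k)" "transpose (D x) = D x" for x j k
    using g_C2 by (auto simp: D_eq C2_partials_diffusion diffusion_symmetric)
  have p_cont: "continuous_on UNIV p" and p1: "C1_partials p"
    using p by (auto dest: C2_partialsD C1_partialsD)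
  have div_cont: "continuous_on UNIV (div_vec f)"
    unfolding div_vec_def[abs_def] by (intro continuous_intros C1_partialsD(3) f)
  have p_meas: "p \<in> borel_measurable lborel" and div_meas: "div_vec f \<in> borel_measurable lborel"
    using p_cont div_cont by (auto intro: borel_measurable_continuous_onI)

  have int_p: "integrable lborel p"
    using p_mass p_meas p_pos by (intro integrableI_nonneg) (auto intro!: AE_I2 less_imp_le)
  have mass: "(\<integral>x. p x \<partial>lborel) = 1"
    using p_mass p_meas p_pos by (subst integral_eq_nn_integral) (auto intro!: AE_I2 less_imp_le)
  have int_div: "integrable lborel (\<lambda>x. div_vec f x * p x)"
    using div_finite p_pos p_meas div_meas
    by (intro integrableI_bounded) (auto simp: expect_abs_def abs_mult abs_of_pos)

  \<comment> \<open>Both fluxes thus have the same drift term \<open>f x \<bullet> grad p x\<close>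
    in their divergence, and it cancels on subtraction.\<close>
  have grad_w: "p x * (f x \<bullet> grad ?w x) = f x \<bullet> grad p x" for x
  proof -
    have "partial_deriv k ?w x = 1 / p x * partial_deriv k p x" for k
      using p_pos by (intro partial_deriv_compose(2) DERIV_ln_divide C1_partialsD(1)[OF p1])
    then show ?thesis
      using p_pos[of x] by (simp add: grad_def inner_vec_def sum_distrib_left)
  qed

  define tr where "tr x = trace (D x ** hessian ?w x)" for x
  have tr_le: "tr x \<le> - (?n * lam * mu)" for x
    unfolding tr_def D_eq
  proof (rule trace_diffusion_mult_le[OF _ transpose_hessian[OF w] _ mu_pos])
    have "ereal lam \<le> ereal (lambda_min (D x))" unfolding lam_eq by (rule INF_lower) simp
    then show "lam \<le> lambda_min (diffusion g x)" by (simp add: D_eq)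
    have "ereal (lambda_max (hessian ?w x)) \<le> - ereal mu"
      unfolding mu_eq ereal_uminus_uminus by (rule SUP_upper) simp
    then show "lambda_max (hessian ?w x) \<le> - mu" by simp
  qed

  have gen: "p x * generator f D ?w x - ln (p x) * adjoint_generator f D p x = f x \<bullet> grad p x + 1/2 * (p x * tr x)" for x
    by (simp add: p_adj generator_def distrib_left grad_w tr_def)
  \<comment> \<open>With the zero matrix the generator is the drift derivative, and the adjoint
    applied to 1 is \<open>- div_vec f x\<close>.\<close>
  have one: "1 * generator f (\<lambda>_. 0) p x - p x * adjoint_generator f (\<lambda>_. 0) (\<lambda>_. 1) x
      = f x \<bullet> grad p x + p x * div_vec f x" for x
    by (simp add: generator_def adjoint_generator_def div2_def trace_def)
  note lim1 = decaying_integral_tendsto_0[OF f D p w decay_log, unfolded gen]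
  have lim2: "(\<lambda>i. \<integral>x. cutoff (real (Suc i)) x * (f x \<bullet> grad p x + p x * div_vec f x) \<partial>lborel) \<longlonglongrightarrow> 0"
    using decaying_integral_tendsto_0[OF f _ _ _ p decay_one] unfolding one by (simp add: transpose_def vec_eq_iff)

  have grad_cont: "continuous_on UNIV (\<lambda>x. f x \<bullet> grad p x)"
    unfolding inner_vec_def grad_def
    by (simp, intro continuous_intros C1_partialsD(2)[OF f] C1_partialsD(3)[OF p1])
  have D_cont: "continuous_on UNIV (\<lambda>x. D x $ j $ k)" for j k
    using D(1) by (meson C1_partialsD(2) C2_partialsD(1))
  have hess_cont: "continuous_on UNIV (\<lambda>x. partial_deriv j (partial_deriv k ?w) x)" for j k
    using w by (meson C1_partialsD(3) C2_partialsD(2))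
  have tr_cont: "continuous_on UNIV tr"
    unfolding tr_def trace_def matrix_matrix_mult_def hessian_def
    by (simp, intro continuous_intros D_cont hess_cont)
  \<comment> \<open>The comparison is made under the cutoff, where continuity and compact support
    make every term integrable, including the drift term; limits are taken afterwards.\<close>
  have le: "(\<integral>x. cutoff (real (Suc i)) x * (div_vec f x * p x + ?n * lam * mu / 2 * p x) \<partial>lborel)
      \<le> (\<integral>x. cutoff (real (Suc i)) x * (f x \<bullet> grad p x + p x * div_vec f x) \<partial>lborel)
        - (\<integral>x. cutoff (real (Suc i)) x * (f x \<bullet> grad p x + 1/2 * (p x * tr x)) \<partial>lborel)" for i
  proof -
    \<comment> \<open>After the drift terms cancel, this is \<open>tr_le\<close> multiplied by
      \<open>p x / 2\<close>.\<close>
    have "div_vec f x * p x + ?n * lam * mu / 2 * p x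
        \<le> (f x \<bullet> grad p x + p x * div_vec f x) - (f x \<bullet> grad p x + 1/2 * (p x * tr x))" for x
      using mult_left_mono[OF tr_le[of x] less_imp_le[OF p_pos[of x]]] by (simp add: algebra_simps)
    then have pw: "cutoff (real (Suc i)) x * (div_vec f x * p x + ?n * lam * mu / 2 * p x)
        \<le> cutoff (real (Suc i)) x * (f x \<bullet> grad p x + p x * div_vec f x)
          - cutoff (real (Suc i)) x * (f x \<bullet> grad p x + 1/2 * (p x * tr x))" for x
      unfolding right_diff_distrib[symmetric] by (intro mult_left_mono cutoff_range)
    have ints: "integrable lborel (\<lambda>x. cutoff (real (Suc i)) x * (div_vec f x * p x + ?n * lam * mu / 2 * p x))"
      "integrable lborel (\<lambda>x. cutoff (real (Suc i)) x * (f x \<bullet> grad p x + p x * div_vec f x))"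
      "integrable lborel (\<lambda>x. cutoff (real (Suc i)) x * (f x \<bullet> grad p x + 1/2 * (p x * tr x)))"
      by (intro integrable_cutoff_mult continuous_intros p_cont div_cont grad_cont tr_cont; simp)+
    show ?thesis
      unfolding Bochner_Integration.integral_diff[OF ints(2,3), symmetric]
      by (intro integral_mono ints Bochner_Integration.integrable_diff pw)
  qed
  \<comment> \<open>On this side the cutoff can be removed, since \<open>div_vec f x * p x\<close>
    is integrable and \<open>p\<close> has mass 1.\<close>
  have lim3: "(\<lambda>i. \<integral>x. cutoff (real (Suc i)) x * (div_vec f x * p x + ?n * lam * mu / 2 * p x) \<partial>lborel)
      \<longlonglongrightarrow> (\<integral>x. div_vec f x * p x + ?n * lam * mu / 2 * p x \<partial>lborel)"
    by (intro integral_cutoff_tendsto Bochner_Integration.integrable_add int_div integrable_mult_right int_p)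
  have "(\<integral>x. div_vec f x * p x + ?n * lam * mu / 2 * p x \<partial>lborel) \<le> 0 - 0"
    by (rule LIMSEQ_le[OF lim3 tendsto_diff[OF lim2 lim1]]) (use le in blast)
  moreover have "(\<integral>x. div_vec f x * p x + ?n * lam * mu / 2 * p x \<partial>lborel)
      = expect p (div_vec f) + ?n * lam * mu / 2"
    using int_div int_p mass by (simp add: expect_def)
  ultimately have E: "expect p (div_vec f) \<le> - (?n * (lam * mu) / 2)" by (simp add: mult.assoc)
  have "0 < ?n * (lam * mu)" using lam_pos mu_pos by simp
  then have neg: "expect p (div_vec f) < 0" using E by linarith
  \<comment> \<open>Negativity of the expectation is what permits dividing \<open>E\<close> by it
    with the correct direction of the inequality.\<close>
  moreover have "- (?n / (2 * expect p (div_vec f))) \<le> 1 / (lam * mu)"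
    using E neg lam_pos mu_pos by (simp add: field_simps)
  ultimately show ?thesis by (simp add: K_eq)
qed

end
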